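(* Let $\lambda_n(z)\,|dz|$, $n=1,2,\dots$, and $\mu(z)\,|dz|$ be conformal pseudometrics on the unit disk $\mathbb{D}$ such that each $\lambda_n(z)\,|dz|$ has only isolated zeros (with $\kappa_{\lambda_n}$ bounded below in a punctured neighborhood of each zero of $\lambda_n$) and $\kappa_\mu=\kappa$ for some locally H\"older continuous function $\kappa:\mathbb{D}\to\mathbb{R}$ with $\kappa(z)\le-4$ in $\mathbb{D}$. Suppose that $$\lambda_n\preceq\mu\ \text{ for every } n\in\mathbb{N}\qquad\text{and}\qquad\lim_{n\to\infty}\frac{\lambda_n(z_n)}{\mu(z_n)}=1$$ for some sequence $(z_n)$ in $\mathbb{D}$ with $z_n\to z_0\in\mathbb{D}$. Then for every $\xi\in\mathbb{D}$ the following hold: (a) If $\beta\ge0$ resp. $\beta_n\ge0$ denotes the order of $\xi$ as a zero of $\mu(z)\,|dz|$ resp. $\lambda_n(z)\,|dz|$, then $\beta_n\to\beta$. (b) If $\lambda_n(z)\,|dz|$ has a zero $\xi_n\in\mathbb{D}\setminus\{\xi\}$ of order $\alpha_n\ge0$ such that $\xi_n\to\xi$, then $\alpha_n\to0$.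
   Context: A conformal pseudometric $\lambda(z)\,|dz|$ on a domain $G\subset\mathbb{C}$ is a continuous function $\lambda:G\to[0,\infty)$ which is of class $C^2$ on $\{\lambda>0\}$; its curvature $\kappa_\lambda(z)=-\Delta(\log\lambda)(z)/\lambda(z)^2$ is defined where $\lambda(z)>0$, and (in)equalities for $\kappa_\lambda$ are understood at all points with $\lambda(z)>0$. One writes $\lambda\preceq\mu$ on $G$ if (i) $\kappa_\lambda\le\kappa_\mu$ in $G$, and (ii) $\mu$ has only isolated zeros in $G$ and $\lambda/\mu$ has a continuous extension from $\{z\in G:\mu(z)\ne 0\}$ to $G$ with values in $[0,1]$; then $\lambda(z)/\mu(z)$ denotes the value of this extension at any $z\in G$. If $\xi$ is an isolated zero of a conformal pseudometric $\lambda$ whose curvature satisfies $-c'\le\kappa_\lambda\le-4$ (some $c'>0$) in a punctured neighborhood of $\xi$, its order is the unique real number $\alpha>0$ for which $\lim_{z\to\xi}\lambda(z)/|z-\xi|^\alpha$ exists and is non-zero (such $\alpha$ always exists). By convention $\xi$ is called a zero of order $0$ if $\lambda(\xi)\neq0$. *)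

theory Defs
  imports "HOL-Analysis.Analysis"
begin

(* Meaningful for open U: D1 and D2 are the first and second Frechet derivatives. *)
definition C2_on :: "complex set \<Rightarrow> (complex \<Rightarrow> real) \<Rightarrow> bool" where
  "C2_on U f \<longleftrightarrow>
    (\<exists>(D1 :: complex \<Rightarrow> complex \<Rightarrow>\<^sub>L real) (D2 :: complex \<Rightarrow> complex \<Rightarrow>\<^sub>L complex \<Rightarrow>\<^sub>L real).
      (\<forall>z\<in>U. (f has_derivative blinfun_apply (D1 z)) (at z)) \<and>
      (\<forall>z\<in>U. (D1 has_derivative blinfun_apply (D2 z)) (at z)) \<and>
      continuous_on U D2)"

definition partial_deriv :: "complex \<Rightarrow> (complex \<Rightarrow> real) \<Rightarrow> complex \<Rightarrow> real" where
  "partial_deriv v f z = deriv (\<lambda>t::real. f (z + of_real t * v)) 0"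

definition laplacian :: "(complex \<Rightarrow> real) \<Rightarrow> complex \<Rightarrow> real" where
  "laplacian f z =
    partial_deriv 1 (partial_deriv 1 f) z + partial_deriv \<i> (partial_deriv \<i> f) z"

definition conformal_pseudometric :: "complex set \<Rightarrow> (complex \<Rightarrow> real) \<Rightarrow> bool" where
  "conformal_pseudometric G lam \<longleftrightarrow>
    open G \<and> connected G \<and>
    continuous_on G lam \<and> (\<forall>z\<in>G. 0 \<le> lam z) \<and> C2_on {z\<in>G. lam z > 0} lam"

(* Meaningful only at points of the domain where lam is positive; every use below is
   restricted to such points. *)
definition curvature :: "(complex \<Rightarrow> real) \<Rightarrow> complex \<Rightarrow> real" where
  "curvature lam z = - laplacian (\<lambda>w. ln (lam w)) z / (lam z)\<^sup>2"

definition only_isolated_zeros :: "complex set \<Rightarrow> (complex \<Rightarrow> real) \<Rightarrow> bool" where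
  "only_isolated_zeros G lam \<longleftrightarrow> discrete {z\<in>G. lam z = 0}"

definition quotient_extension ::
  "complex set \<Rightarrow> (complex \<Rightarrow> real) \<Rightarrow> (complex \<Rightarrow> real) \<Rightarrow> (complex \<Rightarrow> real) \<Rightarrow> bool" where
  "quotient_extension G lam mu h \<longleftrightarrow>
    continuous_on G h \<and> h ` G \<subseteq> {0..1} \<and>
    (\<forall>z\<in>G. mu z \<noteq> 0 \<longrightarrow> h z = lam z / mu z)"

(* The relation written lam \<preceq> mu on G. *)
definition pseudometric_le ::
  "complex set \<Rightarrow> (complex \<Rightarrow> real) \<Rightarrow> (complex \<Rightarrow> real) \<Rightarrow> bool" where
  "pseudometric_le G lam mu \<longleftrightarrow>
    (\<forall>z\<in>G. lam z > 0 \<and> mu z > 0 \<longrightarrow> curvature lam z \<le> curvature mu z) \<and>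
    only_isolated_zeros G mu \<and>
    (\<exists>h. quotient_extension G lam mu h)"

(* The value lam(z)/mu(z) when pseudometric_le G lam mu holds; the choice is then unique on G,
   see quotient_extension_unique. *)
definition quotient_value ::
  "complex set \<Rightarrow> (complex \<Rightarrow> real) \<Rightarrow> (complex \<Rightarrow> real) \<Rightarrow> complex \<Rightarrow> real" where
  "quotient_value G lam mu = (SOME h. quotient_extension G lam mu h)"

(* alpha is the order of xi as a zero of lam, with order 0 at points where lam does not vanish.
   At most one alpha qualifies, see has_zero_order_unique. *)
definition has_zero_order :: "(complex \<Rightarrow> real) \<Rightarrow> complex \<Rightarrow> real \<Rightarrow> bool" where
  "has_zero_order lam \<xi> \<alpha> \<longleftrightarrow>
    (if lam \<xi> \<noteq> 0 then \<alpha> = 0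
     else \<alpha> > 0 \<and>
       (\<exists>L. L \<noteq> 0 \<and> ((\<lambda>z. lam z / norm (z - \<xi>) powr \<alpha>) \<longlongrightarrow> L) (at \<xi>)))"

(* The exponent and the constant may depend on the neighbourhood. *)
definition locally_holder_on :: "complex set \<Rightarrow> (complex \<Rightarrow> real) \<Rightarrow> bool" where
  "locally_holder_on G f \<longleftrightarrow>
    (\<forall>z\<in>G. \<exists>r>0. \<exists>a C. 0 < a \<and> a \<le> 1 \<and> ball z r \<subseteq> G \<and>
      (\<forall>x\<in>ball z r. \<forall>y\<in>ball z r. \<bar>f x - f y\<bar> \<le> C * norm (x - y) powr a))"

lemma quotient_extension_unique:
  assumes G: "open G" and iso: "only_isolated_zeros G mu"
    and h: "quotient_extension G lam mu h" and k: "quotient_extension G lam mu k"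
    and z: "z \<in> G"
  shows "h z = k z"
proof (cases "mu z = 0")
  case False
  then show ?thesis using h k z by (simp add: quotient_extension_def)
next
  case True
  then have "z isolated_in {z\<in>G. mu z = 0}"
    using iso z by (simp add: only_isolated_zeros_def discrete_def)
  then obtain T where T: "open T" "T \<inter> {z\<in>G. mu z = 0} = {z}"
    by (auto simp: isolated_in_def)
  have ev: "eventually (\<lambda>w. h w = k w) (at z)"
    unfolding eventually_at_topological
  proof (intro exI conjI ballI impI)
    show "open (T \<inter> G)" "z \<in> T \<inter> G" using T G z by auto
    fix w assume w: "w \<in> T \<inter> G" "w \<noteq> z"
    with T have "mu w \<noteq> 0" by blast
    with w h k show "h w = k w" by (simp add: quotient_extension_def)
  qed
  have "(h \<longlongrightarrow> h z) (at z)" "(k \<longlongrightarrow> k z) (at z)"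
    using h k G z continuous_on_eq_continuous_at[OF G]
    by (auto simp: quotient_extension_def isCont_def)
  then show ?thesis
    using tendsto_cong[OF ev] LIM_unique by blast
qed

lemma has_zero_order_unique:
  assumes "has_zero_order lam \<xi> \<alpha>" "has_zero_order lam \<xi> \<beta>"
  shows "\<alpha> = \<beta>"
proof -
  have False
    if "a < b" and L: "L \<noteq> 0" "((\<lambda>z. lam z / norm (z - \<xi>) powr a) \<longlongrightarrow> L) (at \<xi>)"
      and M: "((\<lambda>z. lam z / norm (z - \<xi>) powr b) \<longlongrightarrow> M) (at \<xi>)" for a b L M :: real
  proof -
    have "((\<lambda>z. norm (z - \<xi>)) \<longlongrightarrow> 0) (at \<xi>)"
      using LIM_offset_zero_iff[of \<xi> norm] by (intro tendsto_eq_intros) auto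
    then have "((\<lambda>z. norm (z - \<xi>) powr (b - a)) \<longlongrightarrow> 0) (at \<xi>)"
      using \<open>a < b\<close> tendsto_powr2[of "\<lambda>z. norm (z - \<xi>)" 0 "at \<xi>" "\<lambda>_. b - a" "b - a"]
      by auto
    from tendsto_mult[OF M this]
    have "((\<lambda>z. lam z / norm (z - \<xi>) powr b * norm (z - \<xi>) powr (b - a)) \<longlongrightarrow> 0) (at \<xi>)"
      by simp
    then have "((\<lambda>z. lam z / norm (z - \<xi>) powr a) \<longlongrightarrow> 0) (at \<xi>)"
      by (rule Lim_transform_eventually) (auto simp: eventually_at_filter powr_diff)
    with L show False using LIM_unique by blast
  qed
  then have le: "\<not> a < b" if "has_zero_order lam \<xi> a" "has_zero_order lam \<xi> b" for a b
    using that unfolding has_zero_order_def by (cases "lam \<xi> = 0") auto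
  from le[OF assms] le[OF assms(2,1)] show ?thesis by simp
qed

end

theory Submission
  imports Defs
begin

text \<open>
  Let \<open>h\<^sub>n\<close> be the continuous extension of \<open>\<lambda>\<^sub>n / \<mu>\<close> and \<open>u = ln h\<^sub>n \<le> 0\<close>. Off the zeros, the
  curvature inequality gives \<open>\<Delta>u \<ge> -\<kappa> \<mu>\<^sup>2 (exp (2 u) - 1) \<ge> -2 \<kappa> \<mu>\<^sup>2 u\<close>, hence \<open>\<Delta>u \<ge> C u\<close> locally
  with \<open>C\<close> independent of \<open>n\<close>. Comparison with a Gaussian barrier on annuli shows that a bound
  \<open>h\<^sub>n \<le> q < 1\<close> which is uniform in infinitely many \<open>n\<close> on one small disk spreads to every compact
  set, contradicting \<open>h\<^sub>n(z\<^sub>n) \<rightarrow> 1\<close>. If \<open>h\<^sub>n\<close> vanishes at \<open>p\<^sub>n\<close> to order at least \<open>\<delta>\<close> and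
  \<open>p\<^sub>n \<rightarrow> \<xi>\<close>, a barrier with a logarithmic pole at \<open>p\<^sub>n\<close> produces such a uniform bound near \<open>\<xi>\<close>.
  So the orders of \<open>h\<^sub>n\<close> at \<open>p\<^sub>n\<close> tend to \<open>0\<close>; both claims are instances of this.
\<close>

subsection \<open>Pointwise Laplacians\<close>

text \<open>\<open>deriv\<close> is total and returns a default where no derivative exists, so
  \<open>laplacian\<close> alone carries no information on differentiability. The relational form
  asserts existence: \<open>D\<close> is the directional derivative near \<open>z\<close>, and
  \<open>D\<close> is again differentiable along \<open>d\<close> at \<open>z\<close>.\<close>

definition has_second_deriv :: "complex \<Rightarrow> (complex \<Rightarrow> real) \<Rightarrow> complex \<Rightarrow> real \<Rightarrow> bool" where
  "has_second_deriv d f z a \<longleftrightarrow>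
    (\<exists>D. (\<forall>\<^sub>F w in nhds z. ((\<lambda>t. f (w + of_real t * d)) has_real_derivative D w) (at 0)) \<and>
         ((\<lambda>t. D (z + of_real t * d)) has_real_derivative a) (at 0))"

definition has_laplacian :: "(complex \<Rightarrow> real) \<Rightarrow> complex \<Rightarrow> real \<Rightarrow> bool" where
  "has_laplacian f z L \<longleftrightarrow>
    (\<exists>a b. L = a + b \<and> has_second_deriv 1 f z a \<and> has_second_deriv \<i> f z b)"

lemma eventually_nhds_line:
  assumes "\<forall>\<^sub>F w in nhds (z::complex). P w"
  shows "\<forall>\<^sub>F t::real in nhds 0. P (z + of_real t * d)"
proof -
  have "((\<lambda>t::real. z + of_real t * d) \<longlongrightarrow> z + of_real 0 * d) (nhds 0)"
    by (intro tendsto_intros filterlim_ident)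
  then show ?thesis
    using assms by (auto simp: filterlim_iff)
qed

text \<open>Near \<open>z\<close> the witness \<open>D\<close> coincides with
  \<open>partial_deriv d f\<close>, and the second differentiation at \<open>z\<close> depends only
  on values near \<open>z\<close>.\<close>

lemma has_second_deriv_imp:
  assumes "has_second_deriv d f z a"
  shows "partial_deriv d (partial_deriv d f) z = a"
proof -
  obtain D where D: "\<forall>\<^sub>F w in nhds z. ((\<lambda>t. f (w + of_real t * d)) has_real_derivative D w) (at 0)"
    "((\<lambda>t. D (z + of_real t * d)) has_real_derivative a) (at 0)"
    using assms by (auto simp: has_second_deriv_def)
  have "\<forall>\<^sub>F w in nhds z. partial_deriv d f w = D w"
    using D(1) by eventually_elim (simp add: partial_deriv_def DERIV_imp_deriv)
  then have "\<forall>\<^sub>F t in nhds 0. partial_deriv d f (z + of_real t * d) = D (z + of_real t * d)"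
    by (rule eventually_nhds_line)
  then have "((\<lambda>t. partial_deriv d f (z + of_real t * d)) has_real_derivative a) (at 0)"
    using D(2) by (subst DERIV_cong_ev[OF refl _ refl])
  then show ?thesis
    unfolding partial_deriv_def[of d "partial_deriv d f"] by (rule DERIV_imp_deriv)
qed

lemma has_laplacian_imp: "has_laplacian f z L \<Longrightarrow> laplacian f z = L"
  by (auto simp: has_laplacian_def laplacian_def has_second_deriv_imp)

lemma has_second_deriv_add:
  assumes "has_second_deriv d f z a" "has_second_deriv d g z b"
  shows "has_second_deriv d (\<lambda>w. f w + g w) z (a + b)"
proof -
  obtain D where D: "\<forall>\<^sub>F w in nhds z. ((\<lambda>t. f (w + of_real t * d)) has_real_derivative D w) (at 0)"
    "((\<lambda>t. D (z + of_real t * d)) has_real_derivative a) (at 0)"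
    using assms by (auto simp: has_second_deriv_def)
  obtain E where E: "\<forall>\<^sub>F w in nhds z. ((\<lambda>t. g (w + of_real t * d)) has_real_derivative E w) (at 0)"
    "((\<lambda>t. E (z + of_real t * d)) has_real_derivative b) (at 0)"
    using assms by (auto simp: has_second_deriv_def)
  show ?thesis
    unfolding has_second_deriv_def
  proof (intro exI conjI)
    show "\<forall>\<^sub>F w in nhds z. ((\<lambda>t. f (w + of_real t * d) + g (w + of_real t * d))
        has_real_derivative D w + E w) (at 0)"
      using D(1) E(1) by eventually_elim (rule DERIV_add)
    show "((\<lambda>t. D (z + of_real t * d) + E (z + of_real t * d)) has_real_derivative a + b) (at 0)"
      using D(2) E(2) by (rule DERIV_add)
  qed
qed

lemma has_laplacian_add:
  assumes "has_laplacian f z L" "has_laplacian g z M"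
  shows "has_laplacian (\<lambda>w. f w + g w) z (L + M)"
proof -
  obtain a b where f: "L = a + b" "has_second_deriv 1 f z a" "has_second_deriv \<i> f z b"
    using assms(1) by (auto simp: has_laplacian_def)
  obtain a' b' where g: "M = a' + b'" "has_second_deriv 1 g z a'" "has_second_deriv \<i> g z b'"
    using assms(2) by (auto simp: has_laplacian_def)
  have "L + M = (a + a') + (b + b')"
    using f(1) g(1) by simp
  with has_second_deriv_add[OF f(2) g(2)] has_second_deriv_add[OF f(3) g(3)] show ?thesis
    unfolding has_laplacian_def by blast
qed

lemma has_second_deriv_cmult:
  assumes "has_second_deriv d f z a"
  shows "has_second_deriv d (\<lambda>w. c * f w) z (c * a)"
proof -
  obtain D where D: "\<forall>\<^sub>F w in nhds z. ((\<lambda>t. f (w + of_real t * d)) has_real_derivative D w) (at 0)"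
    "((\<lambda>t. D (z + of_real t * d)) has_real_derivative a) (at 0)"
    using assms by (auto simp: has_second_deriv_def)
  show ?thesis
    unfolding has_second_deriv_def
  proof (intro exI conjI)
    show "\<forall>\<^sub>F w in nhds z. ((\<lambda>t. c * f (w + of_real t * d)) has_real_derivative c * D w) (at 0)"
      using D(1) by eventually_elim (rule DERIV_cmult)
    show "((\<lambda>t. c * D (z + of_real t * d)) has_real_derivative c * a) (at 0)"
      using D(2) by (rule DERIV_cmult)
  qed
qed

lemma has_laplacian_cmult:
  assumes "has_laplacian f z L"
  shows "has_laplacian (\<lambda>w. c * f w) z (c * L)"
proof -
  obtain a b where f: "L = a + b" "has_second_deriv 1 f z a" "has_second_deriv \<i> f z b"
    using assms(1) by (auto simp: has_laplacian_def)
  have "c * L = c * a + c * b"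
    using f(1) by (simp add: distrib_left)
  with has_second_deriv_cmult[OF f(2)] has_second_deriv_cmult[OF f(3)] show ?thesis
    unfolding has_laplacian_def by blast
qed

lemma has_second_deriv_cong:
  assumes "has_second_deriv d f z a" "\<forall>\<^sub>F w in nhds z. f w = g w"
  shows "has_second_deriv d g z a"
proof -
  obtain D where D: "\<forall>\<^sub>F w in nhds z. ((\<lambda>t. f (w + of_real t * d)) has_real_derivative D w) (at 0)"
    "((\<lambda>t. D (z + of_real t * d)) has_real_derivative a) (at 0)"
    using assms by (auto simp: has_second_deriv_def)
  \<comment> \<open>The equality must hold around each nearby \<open>w\<close>, not only at
    \<open>w\<close>, for the first derivatives there to agree.\<close>
  have "\<forall>\<^sub>F w in nhds z. \<forall>\<^sub>F w in nhds w. f w = g w"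
    using assms(2) by (simp add: eventually_eventually)
  then have "\<forall>\<^sub>F w in nhds z. ((\<lambda>t. g (w + of_real t * d)) has_real_derivative D w) (at 0)"
    using D(1)
  proof eventually_elim
    case (elim w)
    show ?case
      by (rule DERIV_cong_ev[OF refl eventually_nhds_line[OF elim(1)] refl, THEN iffD1, OF elim(2)])
  qed
  with D(2) show ?thesis
    unfolding has_second_deriv_def by blast
qed

lemma has_laplacian_cong:
  assumes "has_laplacian f z L" "\<forall>\<^sub>F w in nhds z. f w = g w"
  shows "has_laplacian g z L"
  using assms has_second_deriv_cong unfolding has_laplacian_def by blast

text \<open>If \<open>a > 0\<close>, the first derivative along the line vanishes at 0 and is
  positive just to the right of it, so the mean value theorem makes \<open>f\<close> exceed its
  maximum.\<close>

lemma has_second_deriv_local_max: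
  assumes "has_second_deriv d f z a" and max: "\<forall>\<^sub>F w in nhds z. f w \<le> f z"
  shows "a \<le> 0"
proof (rule ccontr)
  assume "\<not> a \<le> 0"
  then have "a > 0" by simp
  obtain D where D: "\<forall>\<^sub>F w in nhds z. ((\<lambda>t. f (w + of_real t * d)) has_real_derivative D w) (at 0)"
    "((\<lambda>t. D (z + of_real t * d)) has_real_derivative a) (at 0)"
    using assms by (auto simp: has_second_deriv_def)
  define \<phi> where "\<phi> t = f (z + of_real t * d)" for t :: real
  define \<psi> where "\<psi> t = D (z + of_real t * d)" for t :: real
  have "\<forall>\<^sub>F t in nhds 0. ((\<lambda>s. f ((z + of_real t * d) + of_real s * d))
      has_real_derivative \<psi> t) (at 0)"
    unfolding \<psi>_def by (rule eventually_nhds_line[OF D(1)])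
  then have ev1: "\<forall>\<^sub>F t in nhds 0. (\<phi> has_real_derivative \<psi> t) (at t)"
  proof eventually_elim
    case (elim t)
    \<comment> \<open>Derivatives are recorded at parameter 0 with a moving base point; a
      translation turns this into the derivative of \<open>\<phi>\<close> at
      \<open>t\<close>.\<close>
    have "((\<lambda>s. \<phi> (s + t)) has_real_derivative \<psi> t) (at 0)"
      using elim by (simp add: \<phi>_def algebra_simps)
    then show ?case
      using DERIV_shift[of \<phi> "\<psi> t" 0 t] by simp
  qed
  have ev2: "\<forall>\<^sub>F t in nhds 0. \<phi> t \<le> \<phi> 0"
    using eventually_nhds_line[OF max] by (simp add: \<phi>_def)
  obtain e where "e > 0" and e: "\<And>t. \<bar>t\<bar> < e \<Longrightarrow> (\<phi> has_real_derivative \<psi> t) (at t)"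
      "\<And>t. \<bar>t\<bar> < e \<Longrightarrow> \<phi> t \<le> \<phi> 0"
    using eventually_conj[OF ev1 ev2]
    by (auto simp: eventually_nhds_metric dist_real_def)
  have "\<psi> 0 = 0"
    using DERIV_local_max[OF e(1)[of 0] \<open>e > 0\<close>] e(2) \<open>e > 0\<close> by simp
  obtain d' where d': "d' > 0" "\<And>t. 0 < t \<Longrightarrow> t < d' \<Longrightarrow> \<psi> 0 < \<psi> (0 + t)"
    using DERIV_pos_inc_right[of \<psi> a 0] D(2) \<open>a > 0\<close> unfolding \<psi>_def by blast
  define t where "t = min e d' / 2"
  have t: "0 < t" "t < e" "t < d'"
    using \<open>e > 0\<close> d'(1) by (auto simp: t_def)
  obtain c where c: "0 < c" "c < t" "\<phi> t - \<phi> 0 = (t - 0) * \<psi> c"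
    using MVT2[of 0 t \<phi> \<psi>, OF t(1) e(1)] t by (auto simp: abs_of_nonneg)
  have "\<psi> c > 0"
    using d'(2)[of c] c t \<open>\<psi> 0 = 0\<close> by simp
  then have "(t - 0) * \<psi> c > 0"
    using t by simp
  then show False
    using c(3) e(2)[of t] t by simp
qed

lemma has_laplacian_local_max:
  assumes "has_laplacian f z L" "\<forall>\<^sub>F w in nhds z. f w \<le> f z"
  shows "L \<le> 0"
proof -
  obtain a b where "L = a + b" "has_second_deriv 1 f z a" "has_second_deriv \<i> f z b"
    using assms(1) by (auto simp: has_laplacian_def)
  then show ?thesis
    using has_second_deriv_local_max[OF _ assms(2), of 1 a]
      has_second_deriv_local_max[OF _ assms(2), of \<i> b] by linarith
qed

section \<open>Laplacians of logarithms of C2 functions and of radial functions\<close>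

lemma C2_on_has_second_deriv_ln:
  assumes f: "C2_on U f" and "open U" "z \<in> U" and pos: "\<And>w. w \<in> U \<Longrightarrow> f w > 0"
  shows "\<exists>a. has_second_deriv d (\<lambda>w. ln (f w)) z a"
proof -
  obtain D1 D2 where
    D1: "\<And>w. w \<in> U \<Longrightarrow> (f has_derivative blinfun_apply (D1 w)) (at w)" and
    D2: "\<And>w. w \<in> U \<Longrightarrow> (D1 has_derivative blinfun_apply (D2 w)) (at w)"
    using f unfolding C2_on_def by blast
  have line: "((\<lambda>t::real. w + of_real t * d) has_derivative (\<lambda>t. t *\<^sub>R d)) (at 0)" for w
    by (auto intro!: derivative_eq_intros simp: scaleR_conv_of_real)
  have f1: "((\<lambda>t. f (w + of_real t * d)) has_real_derivative D1 w d) (at 0)" if "w \<in> U" for w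
  proof -
    have "(f has_derivative blinfun_apply (D1 w)) (at (w + of_real 0 * d))"
      using D1[OF that] by simp
    from has_derivative_compose[OF line this]
    show ?thesis
      by (simp add: has_field_derivative_def blinfun.scaleR_right mult_commute_abs)
  qed
  have d1: "((\<lambda>t. D1 (z + of_real t * d) d) has_real_derivative D2 z d d) (at 0)"
  proof -
    have "(D1 has_derivative blinfun_apply (D2 z)) (at (z + of_real 0 * d))"
      using D2[OF \<open>z \<in> U\<close>] by simp
    from has_derivative_compose[OF line this]
    have "((\<lambda>t. D1 (z + of_real t * d)) has_derivative (\<lambda>t. D2 z (t *\<^sub>R d))) (at 0)" .
    \<comment> \<open>Evaluation of a bounded linear map is bilinear; with the constant argument
      \<open>d\<close> the product rule leaves only the term with \<open>D2\<close>.\<close>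
    from blinfun.FDERIV[OF this has_derivative_const[of d]]
    show ?thesis
      by (simp add: has_field_derivative_def blinfun.scaleR_right blinfun.scaleR_left
          mult_commute_abs)
  qed
  have "has_second_deriv d (\<lambda>w. ln (f w)) z
     ((D2 z d d * f z - D1 z d * D1 z d) / (f z * f z))"
    unfolding has_second_deriv_def
  proof (intro exI conjI)
    have "\<forall>\<^sub>F w in nhds z. w \<in> U"
      using \<open>open U\<close> \<open>z \<in> U\<close> by (rule eventually_nhds_in_open)
    then show "\<forall>\<^sub>F w in nhds z. ((\<lambda>t. ln (f (w + of_real t * d)))
        has_real_derivative D1 w d / f w) (at 0)"
    proof eventually_elim
      case (elim w)
      show ?case
        using f1[OF elim] pos[OF elim] by (auto intro!: derivative_eq_intros)
    qed
    show "((\<lambda>t. D1 (z + of_real t * d) d / f (z + of_real t * d)) has_real_derivative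
        (D2 z d d * f z - D1 z d * D1 z d) / (f z * f z)) (at 0)"
      using DERIV_divide[OF d1 f1[OF \<open>z \<in> U\<close>]] pos[OF \<open>z \<in> U\<close>] by simp
  qed
  then show ?thesis ..
qed

lemma C2_on_has_laplacian_ln:
  assumes "C2_on U f" "open U" "z \<in> U" "\<And>w. w \<in> U \<Longrightarrow> f w > 0"
  shows "has_laplacian (\<lambda>w. ln (f w)) z (laplacian (\<lambda>w. ln (f w)) z)"
proof -
  obtain a where a: "has_second_deriv 1 (\<lambda>w. ln (f w)) z a"
    using C2_on_has_second_deriv_ln[OF assms] by blast
  obtain b where b: "has_second_deriv \<i> (\<lambda>w. ln (f w)) z b"
    using C2_on_has_second_deriv_ln[OF assms] by blast
  have "has_laplacian (\<lambda>w. ln (f w)) z (a + b)"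
    unfolding has_laplacian_def using a b by blast
  then show ?thesis
    by (simp add: has_laplacian_imp)
qed

text \<open>By the chain rule the second derivative along \<open>d\<close> is
  \<open>4 F2 <z - p, d>^2 + 2 F1 |d|^2\<close>; summing over \<open>1\<close> and
  \<open>\<i>\<close> gives \<open>4 s F'' + 4 F'\<close> at \<open>s = |z - p|^2\<close>. The
  squared norm serves as variable because it is smooth at \<open>p\<close> as well.\<close>

lemma has_laplacian_radial:
  assumes F1: "\<forall>\<^sub>F s in nhds ((norm (z - p))\<^sup>2). (F has_real_derivative F1 s) (at s)"
    and F2: "(F1 has_real_derivative F2) (at ((norm (z - p))\<^sup>2))"
  shows "has_laplacian (\<lambda>w. F ((norm (w - p))\<^sup>2)) z
     (4 * (norm (z - p))\<^sup>2 * F2 + 4 * F1 ((norm (z - p))\<^sup>2))"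
proof -
  have q: "((\<lambda>t. (norm (w + of_real t * d - p))\<^sup>2) has_real_derivative 2 * inner (w - p) d) (at 0)"
    for w d
  proof -
    have "((\<lambda>t::real. w + of_real t * d - p) has_derivative (\<lambda>t. t *\<^sub>R d)) (at 0)"
      by (auto intro!: derivative_eq_intros simp: scaleR_conv_of_real)
    from has_derivative_inner[OF this this]
    show ?thesis
      unfolding has_field_derivative_def power2_norm_eq_inner
      by (rule has_derivative_eq_rhs) (auto simp: fun_eq_iff inner_commute)
  qed
  have 1: "has_second_deriv d (\<lambda>w. F ((norm (w - p))\<^sup>2)) z
      (F2 * (2 * inner (z - p) d) * (2 * inner (z - p) d) + F1 ((norm (z - p))\<^sup>2) * (2 * inner d d))"
    for d
    unfolding has_second_deriv_def
  proof (intro exI conjI)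
    have "filterlim (\<lambda>w. (norm (w - p))\<^sup>2) (nhds ((norm (z - p))\<^sup>2)) (nhds z)"
      by (intro tendsto_intros filterlim_ident)
    then have "\<forall>\<^sub>F w in nhds z. (F has_real_derivative F1 ((norm (w - p))\<^sup>2)) (at ((norm (w - p))\<^sup>2))"
      using F1 by (auto simp: filterlim_iff)
    then show "\<forall>\<^sub>F w in nhds z. ((\<lambda>t. F ((norm (w + of_real t * d - p))\<^sup>2)) has_real_derivative
        F1 ((norm (w - p))\<^sup>2) * (2 * inner (w - p) d)) (at 0)"
    proof eventually_elim
      case (elim w)
      then show ?case
        by (intro DERIV_chain2[OF _ q]) simp
    qed
    have a: "((\<lambda>t. F1 ((norm (z + of_real t * d - p))\<^sup>2)) has_real_derivative
        F2 * (2 * inner (z - p) d)) (at 0)"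
      using F2 by (intro DERIV_chain2[OF _ q]) simp
    have b: "((\<lambda>t. 2 * inner (z + of_real t * d - p) d) has_real_derivative 2 * inner d d) (at 0)"
    proof -
      have "(\<lambda>t. 2 * inner (z + of_real t * d - p) d)
          = (\<lambda>t. 2 * inner (z - p) d + t * (2 * inner d d))"
        by (simp add: fun_eq_iff inner_diff_left inner_add_left right_diff_distrib
            distrib_left mult.left_commute flip: scaleR_conv_of_real)
      then show ?thesis
        by (auto intro!: derivative_eq_intros)
    qed
    show "((\<lambda>t. F1 ((norm (z + of_real t * d - p))\<^sup>2) * (2 * inner (z + of_real t * d - p) d))
        has_real_derivative F2 * (2 * inner (z - p) d) * (2 * inner (z - p) d)
          + F1 ((norm (z - p))\<^sup>2) * (2 * inner d d)) (at 0)"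
      by (rule DERIV_cong[OF DERIV_mult[OF a b]]) (simp add: algebra_simps)
  qed
  have n: "(norm (z - p))\<^sup>2 = (Re (z - p))\<^sup>2 + (Im (z - p))\<^sup>2"
    unfolding cmod_power2 ..
  show ?thesis
    unfolding has_laplacian_def
    by (intro exI, rule conjI[OF _ conjI[OF 1[of 1] 1[of \<i>]]])
       (unfold n inner_complex_def, simp add: algebra_simps power2_eq_square)
qed

subsection \<open>Barriers\<close>

text \<open>For \<open>u = ln h\<close> this says that the Laplacian of \<open>u\<close> is at least
  \<open>C u\<close> wherever \<open>u\<close> is finite. Zeros of \<open>h\<close>, where
  \<open>ln\<close> has only a default value, are exempt.\<close>

definition log_subsolution :: "real \<Rightarrow> complex set \<Rightarrow> (complex \<Rightarrow> real) \<Rightarrow> bool" where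
  "log_subsolution C U h \<longleftrightarrow>
    (\<forall>z\<in>U. h z > 0 \<longrightarrow> (\<exists>L\<ge>C * ln (h z). has_laplacian (\<lambda>w. ln (h w)) z L))"

lemma log_subsolution_subset: "log_subsolution C U h \<Longrightarrow> V \<subseteq> U \<Longrightarrow> log_subsolution C V h"
  by (auto simp: log_subsolution_def)

text \<open>For \<open>F = ln\<close> the two terms of the radial formula cancel.\<close>

lemma has_laplacian_ln_norm:
  assumes "z \<noteq> a"
  shows "has_laplacian (\<lambda>w. ln ((norm (w - a))\<^sup>2)) z 0"
proof -
  define s where "s = (norm (z - a))\<^sup>2"
  have s: "s > 0" using assms by (simp add: s_def)
  have "\<forall>\<^sub>F s in nhds ((norm (z - a))\<^sup>2). (ln has_real_derivative 1 / s) (at s)"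
    using eventually_nhds_in_open[of "{0<..}" s] s unfolding s_def
    by (auto elim!: eventually_mono intro!: derivative_eq_intros)
  moreover have "((\<lambda>s. 1 / s) has_real_derivative - 1 / s\<^sup>2) (at ((norm (z - a))\<^sup>2))"
    using s unfolding s_def[symmetric]
    by (auto intro!: derivative_eq_intros simp: power2_eq_square)
  ultimately have "has_laplacian (\<lambda>w. ln ((norm (w - a))\<^sup>2)) z
     (4 * (norm (z - a))\<^sup>2 * (- 1 / s\<^sup>2) + 4 * (1 / (norm (z - a))\<^sup>2))"
    by (rule has_laplacian_radial)
  moreover have "4 * (norm (z - a))\<^sup>2 * (- 1 / s\<^sup>2) + 4 * (1 / (norm (z - a))\<^sup>2) = 0"
    using s unfolding s_def[symmetric] by (simp add: power2_eq_square)
  ultimately show ?thesis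
    by simp
qed

text \<open>
  Nothing is assumed about the differential inequality at the single point \<open>a\<close>: the harmonic
  perturbation \<open>\<epsilon> ln |z - a|\<close> keeps the maximum away from it.
\<close>
lemma log_subsolution_barrier:
  fixes h v :: "complex \<Rightarrow> real"
  assumes K: "compact K" and C: "C > 0"
    and h: "continuous_on K h" "\<And>z. z \<in> K \<Longrightarrow> 0 \<le> h z"
    and hv: "continuous_on K (\<lambda>z. h z * exp (v z))"
    and sub: "log_subsolution C (interior K - {a}) h"
    and v: "\<And>z. z \<in> K \<Longrightarrow> z \<noteq> a \<Longrightarrow> h z * exp (v z) > 1 \<Longrightarrow>
              z \<in> interior K \<and> (\<exists>M\<ge>C * v z. has_laplacian v z M)"
    and x: "x \<in> K" "x \<noteq> a"
  shows "h x * exp (v x) \<le> 1"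
proof (rule ccontr)
  assume "\<not> ?thesis"
  then have x1: "h x * exp (v x) > 1" by simp
  \<comment> \<open>Dividing by \<open>R\<close> keeps the factor
    \<open>(norm (z - a) / R) powr \<epsilon>\<close> at most 1 on \<open>K\<close>, so the
    perturbation can only lower \<open>h z * exp (v z)\<close>.\<close>
  obtain R where R: "R > 0" "\<And>z. z \<in> K \<Longrightarrow> norm (z - a) \<le> R"
  proof -
    have "\<exists>e. \<forall>y\<in>K. dist a y \<le> e"
      using compact_imp_bounded[OF K] unfolding bounded_any_center[of _ a] .
    then obtain e where "\<forall>y\<in>K. dist a y \<le> e" ..
    then have "norm (z - a) \<le> max e 1" if "z \<in> K" for z
      using that by (auto simp: dist_norm norm_minus_commute)
    then show thesis
      by (intro that[of "max e 1"]) auto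
  qed
  \<comment> \<open>As \<open>x\<close> differs from \<open>a\<close>, the factor at
    \<open>x\<close> tends to 1, and the strict violation at \<open>x\<close> survives a small
    \<open>\<epsilon>\<close>.\<close>
  have "((\<lambda>\<epsilon>. h x * exp (v x) * (norm (x - a) / R) powr \<epsilon>)
      \<longlongrightarrow> h x * exp (v x) * (norm (x - a) / R) powr 0) (at_right 0)"
    using x R by (intro tendsto_intros) auto
  then have "((\<lambda>\<epsilon>. h x * exp (v x) * (norm (x - a) / R) powr \<epsilon>) \<longlongrightarrow> h x * exp (v x)) (at_right 0)"
    using x R by simp
  from order_tendstoD(1)[OF this x1]
  have "\<forall>\<^sub>F \<epsilon> in at_right 0. \<epsilon> > 0 \<and> 1 < h x * exp (v x) * (norm (x - a) / R) powr \<epsilon>"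
    by (simp add: eventually_conj eventually_at_right_less)
  then obtain \<epsilon> where \<epsilon>: "\<epsilon> > 0" "1 < h x * exp (v x) * (norm (x - a) / R) powr \<epsilon>"
    using eventually_happens'[OF trivial_limit_at_right_real] by blast
  define g where "g z = h z * exp (v z) * (norm (z - a) / R) powr \<epsilon>" for z
  have "continuous_on K g"
    unfolding g_def using \<epsilon>(1) R(1)
    by (intro continuous_intros hv continuous_on_powr') auto
  then obtain z where z: "z \<in> K" "\<And>w. w \<in> K \<Longrightarrow> g w \<le> g z"
    using continuous_attains_sup[OF K] x(1) by blast
  have gz: "g z > 1"
    using z(2)[OF x(1)] \<epsilon>(2) by (simp add: g_def)
  \<comment> \<open>Here \<open>0 powr \<epsilon> = 0\<close>, so \<open>g\<close> vanishes at
    \<open>a\<close>.\<close>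
  have za: "z \<noteq> a"
    using gz by (auto simp: g_def)
  have hvz: "h z * exp (v z) > 1"
  proof -
    have "(norm (z - a) / R) powr \<epsilon> \<le> 1"
      using R z(1) \<epsilon>(1) by (intro powr_le1) auto
    then have "g z \<le> h z * exp (v z) * 1"
      unfolding g_def using h(2)[OF z(1)] by (intro mult_left_mono) auto
    with gz show ?thesis by simp
  qed
  have hz: "h z > 0"
    using hvz h(2)[OF z(1)] by (cases "h z = 0") auto
  obtain M where zi: "z \<in> interior K" and M: "M \<ge> C * v z" "has_laplacian v z M"
    using v[OF z(1) za hvz] by blast
  obtain L where L: "L \<ge> C * ln (h z)" "has_laplacian (\<lambda>w. ln (h w)) z L"
    using sub zi za hz by (auto simp: log_subsolution_def)
  \<comment> \<open>Near \<open>z\<close>, \<open>F\<close> is \<open>ln g\<close> plus the constant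
    \<open>\<epsilon> * ln R\<close>, so it inherits the maximum of \<open>g\<close>; its last term
    is harmonic off \<open>a\<close>.\<close>
  define F where "F w = ln (h w) + v w + \<epsilon> / 2 * ln ((norm (w - a))\<^sup>2)" for w
  have "has_laplacian F z (L + M + \<epsilon> / 2 * 0)"
    unfolding F_def
    by (intro has_laplacian_add has_laplacian_cmult has_laplacian_ln_norm L M za)
  moreover have "\<forall>\<^sub>F w in nhds z. F w \<le> F z"
  proof -
    have F: "F w = ln (g w) + \<epsilon> * ln R" if "h w > 0" "w \<noteq> a" for w
      using that R(1) by (simp add: F_def g_def ln_mult ln_div ln_powr ln_realpow algebra_simps)
    have "isCont h z"
      using h(1) zi by (meson continuous_on_interior)
    then have "\<forall>\<^sub>F w in nhds z. h w > 0"
      using hz by (simp add: isCont_def order_tendstoD(1) tendsto_at_iff_tendsto_nhds)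
    moreover have "\<forall>\<^sub>F w in nhds z. w \<in> interior K - {a}"
      using zi za by (intro eventually_nhds_in_open) auto
    ultimately show ?thesis
    proof eventually_elim
      case (elim w)
      then have "w \<in> K" "w \<noteq> a" using interior_subset by auto
      moreover have "g w > 0"
        using elim R(1) by (simp add: g_def)
      ultimately show ?case
        using F[of w] F[of z] elim hz za z(2)[of w] by simp
    qed
  qed
  ultimately have "L + M + \<epsilon> / 2 * 0 \<le> 0"
    by (rule has_laplacian_local_max)
  \<comment> \<open>The two differential inequalities bound the Laplacian of \<open>F\<close> below
    by \<open>C * ln (h z * exp (v z))\<close>, which is positive.\<close>
  then have "C * (ln (h z) + v z) \<le> 0"
    using L(1) M(1) by (simp add: distrib_left)
  moreover have "ln (h z * exp (v z)) > 0"
    using hvz by (rule ln_gt_zero)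
  then have "ln (h z) + v z > 0"
    using hz by (simp add: ln_mult)
  ultimately show False
    using C by (simp add: mult_le_0_iff)
qed

text \<open>Recovers by continuity the exceptional point \<open>a\<close> that the barrier
  comparison leaves out.\<close>

lemma continuous_on_le_punctured:
  fixes h :: "complex \<Rightarrow> real"
  assumes "open U" "continuous_on U h" "\<And>z. z \<in> U \<Longrightarrow> z \<noteq> a \<Longrightarrow> h z \<le> q" "z \<in> U"
  shows "h z \<le> q"
proof (cases "z = a")
  case True
  have "(h \<longlongrightarrow> h z) (at z)"
    using assms(1,2,4) by (simp add: continuous_on_eq_continuous_at isCont_def)
  moreover have "\<forall>\<^sub>F w in at z. h w \<le> q"
    using assms(1,3,4) True by (auto simp: eventually_at_topological)
  ultimately show ?thesis
    by (rule tendsto_upperbound) simp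
qed (use assms in auto)

section \<open>The Gaussian barrier and the barrier with a logarithmic pole\<close>

text \<open>Comparison on the annulus between radii \<open>s\<close> and \<open>R\<close>. The bound
  \<open>q'\<close> is chosen before \<open>h\<close>, which makes it uniform over a whole family of
  functions.\<close>

lemma decay_propagates:
  assumes C: "C > 0" and "0 < s" "s < R'" "R' < R" and q: "0 < q" "q < 1"
  shows "\<exists>q'. 0 < q' \<and> q' < 1 \<and>
    (\<forall>h. continuous_on (cball x R) h \<and> h ` cball x R \<subseteq> {0..1} \<and>
         log_subsolution C (ball x R - {a}) h \<and> (\<forall>z\<in>cball x s. h z \<le> q) \<longrightarrow>
         (\<forall>z\<in>ball x R'. h z \<le> q'))"
proof -
  \<comment> \<open>With \<open>t = |z - x|^2\<close>, the Laplacian of \<open>exp (- A * t)\<close>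
    is \<open>A * (4 * t * A - 4) * exp (- A * t)\<close>. This \<open>A\<close> makes the
    coefficient at least \<open>C\<close> once \<open>t\<close> is at least
    \<open>s^2\<close>.\<close>
  define A where "A = 1 + (4 + C) / (4 * s\<^sup>2)"
  have A: "A \<ge> 1" "4 * s\<^sup>2 * A - 4 \<ge> C"
    using C \<open>0 < s\<close> by (auto simp: A_def field_simps)
  define c where "c = - ln q"
  have c: "c > 0" "q * exp c = 1"
    using q by (auto simp: c_def exp_minus)
  \<comment> \<open>The subtracted constant makes \<open>v\<close> vanish on the outer circle; the
    factor \<open>c = - ln q\<close> gives \<open>q * exp (v z) \<le> 1\<close> everywhere.\<close>
  define v where "v z = c * (exp (- A * (norm (z - x))\<^sup>2) - exp (- A * R\<^sup>2))" for z
  \<comment> \<open>The minimum of \<open>v\<close> over the closed disk of radius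
    \<open>R'\<close>, positive because \<open>R' < R\<close>.\<close>
  define c' where "c' = c * (exp (- A * R'\<^sup>2) - exp (- A * R\<^sup>2))"
  have "R'\<^sup>2 < R\<^sup>2"
    using assms by (intro power_strict_mono) auto
  then have "c' > 0"
    using c A(1) by (simp add: c'_def)
  have vc: "v z \<le> c" for z
  proof -
    have "exp (- A * (norm (z - x))\<^sup>2) - exp (- A * R\<^sup>2) \<le> 1"
    proof -
      have "exp (- A * (norm (z - x))\<^sup>2) \<le> 1" "exp (- A * R\<^sup>2) > 0"
        using A(1) by auto
      then show ?thesis by linarith
    qed
    then show ?thesis
      using c by (simp add: v_def mult_le_cancel_left1)
  qed
  have lap: "\<exists>M\<ge>C * v z. has_laplacian v z M" if "norm (z - x) \<ge> s" for z
  proof -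
    define t where "t = (norm (z - x))\<^sup>2"
    have t: "t \<ge> s\<^sup>2"
      using that \<open>0 < s\<close> by (simp add: t_def power_mono)
    have "has_laplacian v z (4 * t * (c * A\<^sup>2 * exp (- A * t)) + 4 * (- c * A * exp (- A * t)))"
      unfolding v_def t_def
      by (rule has_laplacian_radial)
         (auto intro!: derivative_eq_intros always_eventually simp: power2_eq_square)
    moreover have "4 * t * (c * A\<^sup>2 * exp (- A * t)) + 4 * (- c * A * exp (- A * t)) \<ge> C * v z"
    proof -
      have "4 * s\<^sup>2 * A \<le> 4 * t * A"
        using t A(1) by (intro mult_right_mono mult_left_mono) auto
      then have "C \<le> 4 * t * A - 4"
        using A(2) by linarith
      then have "1 * C \<le> A * (4 * t * A - 4)"
        using A(1) C by (intro mult_mono) auto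
      then have "C * (c * exp (- A * t)) \<le> A * (4 * t * A - 4) * (c * exp (- A * t))"
        using c(1) by (intro mult_right_mono) auto
      moreover have "C * v z \<le> C * (c * exp (- A * t))"
        using C c by (simp add: v_def t_def)
      ultimately show ?thesis
        by (simp add: algebra_simps power2_eq_square)
    qed
    ultimately show ?thesis by blast
  qed
  have main: "h z \<le> max q (exp (- c'))"
    if h: "continuous_on (cball x R) h" "h ` cball x R \<subseteq> {0..1}"
      "log_subsolution C (ball x R - {a}) h" "\<forall>z\<in>cball x s. h z \<le> q" and z: "z \<in> ball x R'"
    for h z
  proof (rule continuous_on_le_punctured[OF open_ball _ _ z])
    show "continuous_on (ball x R') h"
      using h(1) by (rule continuous_on_subset) (use assms in auto)
    fix z assume z: "z \<in> ball x R'" "z \<noteq> a"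
    show "h z \<le> max q (exp (- c'))"
    proof (cases "z \<in> cball x s")
      case False
      define K where "K = cball x R - ball x s"
      have "h z * exp (v z) \<le> 1"
      proof (rule log_subsolution_barrier[where K = K and a = a])
        show "compact K"
          unfolding K_def by (intro compact_diff) auto
        show contK: "continuous_on K h"
          using h(1) by (rule continuous_on_subset) (auto simp: K_def)
        show "continuous_on K (\<lambda>z. h z * exp (v z))"
          unfolding v_def by (intro continuous_intros contK)
        show "0 \<le> h z" if "z \<in> K" for z
          using h(2) that by (auto simp: K_def image_subset_iff)
        have "interior K \<subseteq> interior (cball x R)"
          by (rule interior_mono) (auto simp: K_def)
        then show "log_subsolution C (interior K - {a}) h"
          by (intro log_subsolution_subset[OF h(3)]) auto
        show "z \<in> K" "z \<noteq> a"
          using False z assms by (auto simp: K_def)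
        fix w assume w: "w \<in> K" "w \<noteq> a" "1 < h w * exp (v w)"
        have hw: "0 \<le> h w" "h w \<le> 1"
          using h(2) w(1) by (auto simp: K_def image_subset_iff)
        \<comment> \<open>A violation can lie on neither boundary circle: on the outer one
          \<open>v w = 0\<close> and \<open>h w \<le> 1\<close>, on the inner one
          \<open>h w \<le> q\<close> and \<open>v w \<le> c\<close>.\<close>
        have "dist x w \<noteq> R"
        proof
          assume "dist x w = R"
          then have "v w = 0"
            by (simp add: v_def dist_norm norm_minus_commute)
          then show False using w(3) hw by simp
        qed
        moreover have "dist x w \<noteq> s"
        proof
          assume "dist x w = s"
          then have "h w \<le> q" using h(4) by auto
          then have "h w * exp (v w) \<le> q * exp c"
            using vc[of w] hw q by (intro mult_mono) auto
          then show False using c w(3) by simp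
        qed
        ultimately have "w \<in> ball x R - cball x s"
          using w(1) by (auto simp: K_def)
        moreover have "ball x R - cball x s \<subseteq> interior K"
          by (rule interior_maximal) (auto simp: K_def)
        ultimately show "w \<in> interior K \<and> (\<exists>M\<ge>C * v w. has_laplacian v w M)"
          using lap[of w] by (auto simp: dist_norm norm_minus_commute)
      qed (rule C)
      then have "h z \<le> exp (- v z)"
        by (simp add: exp_minus field_simps)
      moreover have "c' \<le> v z"
      proof -
        have "(norm (z - x))\<^sup>2 \<le> R'\<^sup>2"
          using z by (intro power_mono) (auto simp: dist_norm norm_minus_commute)
        then have "A * (norm (z - x))\<^sup>2 \<le> A * R'\<^sup>2"
          using A by (intro mult_left_mono) auto
        then show ?thesis
          using c unfolding c'_def v_def by (intro mult_left_mono) auto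
      qed
      then have "exp (- v z) \<le> exp (- c')" by simp
      ultimately show ?thesis by linarith
    qed (use h(4) in \<open>auto simp: le_max_iff_disj\<close>)
  qed
  show ?thesis
    by (rule exI[of _ "max q (exp (- c'))"]) (use main q \<open>c' > 0\<close> in auto)
qed

text \<open>A barrier that grows like \<open>\<delta> * ln (r / |z - p|)\<close> at \<open>p\<close>
  is admissible because \<open>h\<close> vanishes there faster than \<open>|z - p|\<close> to the
  power \<open>\<delta>\<close>. The bound and the radius depend only on \<open>C\<close>,
  \<open>r\<close> and \<open>\<delta>\<close>, not on \<open>h\<close>; the exceptional point
  \<open>a\<close> may differ from the pole \<open>p\<close>.\<close>

lemma log_pole_decay:
  assumes C: "C > 0" and r: "r > 0" and \<delta>: "\<delta> > 0"
    and h: "continuous_on (cball p r) h" "h ` cball p r \<subseteq> {0..1}"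
    and sub: "log_subsolution C (ball p r - {a}) h"
    and hp: "h p = 0" and lim: "((\<lambda>z. h z * norm (z - p) powr - \<delta>) \<longlongrightarrow> 0) (at p)"
    and z: "z \<in> ball p (r * exp (- 1 - C * r\<^sup>2))"
  shows "h z \<le> exp (- \<delta>)"
proof (rule continuous_on_le_punctured[OF open_ball _ _ z])
  have le_r: "r * exp (- 1 - C * r\<^sup>2) \<le> r"
  proof -
    have "0 \<le> C * r\<^sup>2" using C by simp
    then have "exp (- 1 - C * r\<^sup>2) \<le> 1" by simp
    then show ?thesis using r by simp
  qed
  show "continuous_on (ball p (r * exp (- 1 - C * r\<^sup>2))) h"
    using h(1) by (rule continuous_on_subset) (use le_r in auto)
  fix z assume z: "z \<in> ball p (r * exp (- 1 - C * r\<^sup>2))" "z \<noteq> a"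
  \<comment> \<open>The term linear in the radius has Laplacian \<open>C r / |z - p|\<close>, which beats the unbounded
      \<open>C ln (r / |z - p|)\<close>.\<close>
  define F where "F s = \<delta> * (ln r - ln s / 2 + C * r * (sqrt s - r))" for s
  define v where "v z = F ((norm (z - p))\<^sup>2)" for z
  have v: "v w = \<delta> * (ln (r / norm (w - p)) + C * r * (norm (w - p) - r))" if "w \<noteq> p" for w
    using that r by (simp add: v_def F_def ln_div ln_realpow)
  have lap: "\<exists>M\<ge>C * v w. has_laplacian v w M" if "w \<noteq> p" "w \<in> cball p r" for w
  proof -
    define \<rho> where "\<rho> = norm (w - p)"
    define F1 where "F1 s = \<delta> * (- 1 / (2 * s) + C * r / (2 * sqrt s))" for s
    have \<rho>: "\<rho> > 0" using that by (simp add: \<rho>_def)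
    have "has_laplacian v w (4 * (norm (w - p))\<^sup>2 * (\<delta> * (1 / (2 * \<rho>^4) - C * r / (4 * \<rho>^3)))
       + 4 * F1 ((norm (w - p))\<^sup>2))"
      unfolding v_def
    proof (rule has_laplacian_radial)
      show "\<forall>\<^sub>F s in nhds ((norm (w - p))\<^sup>2). (F has_real_derivative F1 s) (at s)"
        using eventually_nhds_in_open[of "{0<..}" "(norm (w - p))\<^sup>2"] that
        unfolding F_def F1_def
        by (auto elim!: eventually_mono intro!: derivative_eq_intros simp: field_simps)
      have "(F1 has_real_derivative \<delta> * (1 / (2 * \<rho>^4) - C * r / (4 * \<rho>^3))) (at (\<rho>\<^sup>2))"
        unfolding F1_def using \<rho>
        by (auto intro!: derivative_eq_intros simp: field_simps power2_eq_square power3_eq_cube power4_eq_xxxx)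
      then show "(F1 has_real_derivative \<delta> * (1 / (2 * \<rho>^4) - C * r / (4 * \<rho>^3))) (at ((norm (w - p))\<^sup>2))"
        by (simp add: \<rho>_def)
    qed
    \<comment> \<open>The logarithmic part is harmonic off \<open>p\<close>, so only the
      contribution of the linear term remains.\<close>
    also have "4 * (norm (w - p))\<^sup>2 * (\<delta> * (1 / (2 * \<rho>^4) - C * r / (4 * \<rho>^3)))
       + 4 * F1 ((norm (w - p))\<^sup>2) = C * (\<delta> * (r / \<rho>))"
      unfolding F1_def \<rho>_def[symmetric] using \<rho>
      by (simp add: field_simps power2_eq_square power3_eq_cube power4_eq_xxxx)
    finally have "has_laplacian v w (C * (\<delta> * (r / \<rho>)))" .
    moreover have "v w \<le> \<delta> * (r / \<rho>)"
    proof -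
      have "ln (r / \<rho>) \<le> r / \<rho>"
        using r \<rho> by (intro ln_bound) auto
      moreover have "C * r * (\<rho> - r) \<le> 0"
        using that C r by (simp add: \<rho>_def mult_nonneg_nonpos dist_norm norm_minus_commute)
      ultimately show ?thesis
        unfolding v[OF \<open>w \<noteq> p\<close>] \<rho>_def[symmetric] using \<delta> by (intro mult_left_mono) auto
    qed
    ultimately show ?thesis
      using C by (intro exI[of _ "C * (\<delta> * (r / \<rho>))"] conjI mult_left_mono) auto
  qed
  have "h z * exp (v z) \<le> 1"
  proof (rule log_subsolution_barrier[where K = "cball p r" and a = a])
    show "continuous_on (cball p r) (\<lambda>z. h z * exp (v z))"
      unfolding continuous_on_eq_continuous_within
    proof
      fix w assume w: "w \<in> cball p r"
      show "continuous (at w within cball p r) (\<lambda>z. h z * exp (v z))"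
      proof (cases "w = p")
        case False
        have "continuous (at w within cball p r) h"
          using h(1) w by (simp add: continuous_on_eq_continuous_within)
        moreover have "isCont v w"
          unfolding v_def F_def using False by (intro continuous_intros) auto
        then have "continuous (at w within cball p r) v"
          by (rule continuous_at_imp_continuous_at_within)
        ultimately show ?thesis
          by (intro continuous_mult continuous_exp)
      next
        case True
        have "((\<lambda>z. h z * norm (z - p) powr - \<delta> * r powr \<delta>) \<longlongrightarrow> 0 * r powr \<delta>) (at p within cball p r)"
          by (intro tendsto_mult tendsto_const tendsto_within_subset[OF lim]) auto
        then have upper: "((\<lambda>z. h z * norm (z - p) powr - \<delta> * r powr \<delta>) \<longlongrightarrow> 0) (at p within cball p r)"
          by simp
        \<comment> \<open>The linear term of \<open>v\<close> is nonpositive in the disk, so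
          \<open>exp (v z)\<close> is at most \<open>(r / |z - p|) powr \<delta>\<close> and
          \<open>lim\<close> applies. The default value of \<open>v\<close> at \<open>p\<close> is
          harmless, as \<open>h p = 0\<close>.\<close>
        have "((\<lambda>z. h z * exp (v z)) \<longlongrightarrow> 0) (at p within cball p r)"
        proof (rule tendsto_sandwich[OF _ _ tendsto_const upper])
          show "\<forall>\<^sub>F z in at p within cball p r. 0 \<le> h z * exp (v z)"
            using h(2) by (auto simp: eventually_at_filter image_subset_iff)
          have "h z * exp (v z) \<le> h z * norm (z - p) powr - \<delta> * r powr \<delta>"
            if z: "z \<in> cball p r" "z \<noteq> p" for z
          proof -
            have "C * r * (norm (z - p) - r) \<le> 0"
              using C r z by (simp add: mult_nonneg_nonpos dist_norm norm_minus_commute)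
            then have "v z \<le> \<delta> * ln (r / norm (z - p))"
              unfolding v[OF z(2)] using \<delta> by (intro mult_left_mono) auto
            then have "exp (v z) \<le> exp (\<delta> * ln (r / norm (z - p)))"
              by simp
            also have "\<dots> = norm (z - p) powr - \<delta> * r powr \<delta>"
              using r z by (simp add: powr_def ln_div right_diff_distrib exp_diff exp_minus field_simps)
            finally show ?thesis
              using h(2) z by (simp add: mult.assoc mult_left_mono image_subset_iff)
          qed
          then show "\<forall>\<^sub>F z in at p within cball p r.
              h z * exp (v z) \<le> h z * norm (z - p) powr - \<delta> * r powr \<delta>"
            by (simp add: eventually_at_filter)
        qed
        then show ?thesis
          by (simp add: True continuous_within hp)
      qed
    qed
    show "log_subsolution C (interior (cball p r) - {a}) h"
      using sub by simp
    show "z \<in> cball p r"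
      using z(1) le_r by auto
    show "0 \<le> h w" if "w \<in> cball p r" for w
      using h(2) that by (auto simp: image_subset_iff)
    fix w assume w: "w \<in> cball p r" "w \<noteq> a" "1 < h w * exp (v w)"
    have "w \<noteq> p" using w(3) hp by auto
    moreover have "norm (w - p) \<noteq> r"
    proof
      assume "norm (w - p) = r"
      then have "v w = 0" using v[OF \<open>w \<noteq> p\<close>] r by simp
      moreover have "h w \<le> 1" using h(2) w(1) by (auto simp: image_subset_iff)
      ultimately show False using w(3) by simp
    qed
    ultimately show "w \<in> interior (cball p r) \<and> (\<exists>M\<ge>C * v w. has_laplacian v w M)"
      using w(1) lap[of w] by (auto simp: dist_norm norm_minus_commute)
  qed (use C h z in auto)
  then have hz: "h z \<le> exp (- v z)"
    by (simp add: exp_minus field_simps)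
  show "h z \<le> exp (- \<delta>)"
  proof (cases "z = p")
    case False
    define \<rho> where "\<rho> = norm (z - p)"
    have \<rho>: "\<rho> > 0" "\<rho> \<le> r * exp (- 1 - C * r\<^sup>2)"
      using False z by (auto simp: \<rho>_def dist_norm norm_minus_commute)
    \<comment> \<open>The radius is chosen so that the logarithm is at least
      \<open>1 + C r^2\<close>; the linear term costs at most \<open>C r^2\<close>, which leaves
      \<open>v z \<ge> \<delta>\<close>.\<close>
    have "ln (exp (1 + C * r\<^sup>2)) \<le> ln (r / \<rho>)"
    proof (subst ln_le_cancel_iff)
      show "exp (1 + C * r\<^sup>2) \<le> r / \<rho>"
        using \<rho> by (simp add: field_simps exp_diff exp_minus exp_add)
    qed (use \<rho> r in auto)
    moreover have "C * r * (\<rho> - r) \<ge> - (C * r\<^sup>2)"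
      using C r \<rho>(1) by (simp add: algebra_simps power2_eq_square)
    ultimately have "1 \<le> ln (r / \<rho>) + C * r * (\<rho> - r)"
      by simp
    then have "\<delta> * 1 \<le> v z"
      unfolding v[OF False] \<rho>_def using \<delta> by (intro mult_left_mono) auto
    then have "exp (- v z) \<le> exp (- \<delta>)" by simp
    with hz show ?thesis by linarith
  qed (use hp in simp)
qed

subsection \<open>Vanishing orders in families of quotients\<close>

text \<open>Abstracts the quotients \<open>\<lambda>\<^sub>n / \<mu>\<close>. In \<open>sub\<close>
  the constants \<open>R\<close> and \<open>C\<close> are common to all \<open>n\<close>, and the
  centre \<open>a\<close> is removed because it may be a zero of the denominator.\<close>

locale quasi_solution_family =
  fixes G :: "complex set" and h :: "nat \<Rightarrow> complex \<Rightarrow> real"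
    and zs :: "nat \<Rightarrow> complex" and z0 :: complex
  assumes G: "open G" "connected G"
    and cont: "continuous_on G (h n)" and range: "h n ` G \<subseteq> {0..1}"
    and sub: "a \<in> G \<Longrightarrow> \<exists>R C. R > 0 \<and> C > 0 \<and> cball a R \<subseteq> G \<and>
      (\<forall>n. log_subsolution C (cball a R - {a}) (h n))"
    and z0: "z0 \<in> G" "zs \<longlonglongrightarrow> z0" and lim: "(\<lambda>n. h n (zs n)) \<longlonglongrightarrow> 1"
begin

text \<open>By connectedness of \<open>G\<close>, a common bound below 1 near one point spreads to a
  neighbourhood of \<open>z0\<close>, where it contradicts \<open>lim\<close>.\<close>

lemma no_uniform_decay:
  assumes "infinite N" "\<xi> \<in> G" "s > 0" "0 < q" "q < 1"
    and "\<And>n z. n \<in> N \<Longrightarrow> z \<in> ball \<xi> s \<Longrightarrow> h n z \<le> q"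
  shows False
proof -
  define P where "P x \<longleftrightarrow> (\<exists>s>0. \<exists>q. 0 < q \<and> q < 1 \<and> (\<forall>n\<in>N. \<forall>z\<in>ball x s. h n z \<le> q))" for x
  have "P z0"
  proof (rule connected_induction_simple[where P = P, OF G(2) \<open>\<xi> \<in> G\<close> z0(1)])
    show "P \<xi>"
      unfolding P_def using assms by blast
    fix a assume "a \<in> G"
    then obtain R C where R: "R > 0" "C > 0" "cball a R \<subseteq> G"
      "\<And>n. log_subsolution C (cball a R - {a}) (h n)"
      using sub by blast
    \<comment> \<open>The radii fit: \<open>R/8 + R/2 \<le> R\<close> puts the comparison disk
      around \<open>x\<close> inside \<open>cball a R\<close>, and
      \<open>R/8 + R/8 + R/12 = R/3\<close> puts \<open>ball y (R / 12)\<close> inside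
      \<open>ball x (R / 3)\<close>.\<close>
    have "P y" if x: "x \<in> ball a (R / 8)" and y: "y \<in> ball a (R / 8)" and "P x" for x y
    proof -
      obtain s q where s: "s > 0" "0 < q" "q < 1" "\<And>n z. n \<in> N \<Longrightarrow> z \<in> ball x s \<Longrightarrow> h n z \<le> q"
        using \<open>P x\<close> unfolding P_def by blast
      define t where "t = min (s / 2) (R / 8)"
      have t: "0 < t" "t < R / 3" "R / 3 < R / 2" "t < s"
        using s R by (auto simp: t_def)
      obtain q' where q': "0 < q'" "q' < 1"
        "\<And>h. continuous_on (cball x (R / 2)) h \<and> h ` cball x (R / 2) \<subseteq> {0..1} \<and>
         log_subsolution C (ball x (R / 2) - {a}) h \<and> (\<forall>z\<in>cball x t. h z \<le> q) \<Longrightarrow>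
         (\<forall>z\<in>ball x (R / 3). h z \<le> q')"
        using decay_propagates[OF R(2) t(1-3) s(2,3), of x a] by blast
      have in_a: "cball x (R / 2) \<subseteq> cball a R"
        using x R(1) unfolding cball_subset_cball_iff by (auto simp: dist_commute)
      have "h n z \<le> q'" if "n \<in> N" "z \<in> ball y (R / 12)" for n z
      proof -
        have "dist x z < R / 3"
          using x y that dist_triangle[of x z a] dist_triangle[of a z y] by (auto simp: dist_commute)
        moreover have "\<forall>z\<in>ball x (R / 3). h n z \<le> q'"
        proof (intro q'(3) conjI ballI)
          show "continuous_on (cball x (R / 2)) (h n)"
            using in_a R(3) by (intro continuous_on_subset[OF cont]) auto
          show "h n ` cball x (R / 2) \<subseteq> {0..1}"
            using in_a R(3) range[of n] by blast
          show "log_subsolution C (ball x (R / 2) - {a}) (h n)"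
            using in_a by (intro log_subsolution_subset[OF R(4)]) auto
          show "h n z \<le> q" if "z \<in> cball x t" for z
            using s(4)[OF \<open>n \<in> N\<close>, of z] that t(4) by simp
        qed
        ultimately show ?thesis by simp
      qed
      then show "P y"
        unfolding P_def using q'(1,2) R(1) by (intro exI[of _ "R / 12"]) auto
    qed
    then show "\<exists>T. openin (top_of_set G) T \<and> a \<in> T \<and> (\<forall>x\<in>T. \<forall>y\<in>T. P x \<longrightarrow> P y)"
    proof (intro exI[of _ "G \<inter> ball a (R / 8)"] conjI)
      show "openin (top_of_set G) (G \<inter> ball a (R / 8))"
        by (rule openin_open_Int) simp
    qed (use R(1) \<open>a \<in> G\<close> in simp, blast)
  qed
  then obtain s q where s: "s > 0" "q < 1" "\<And>n z. n \<in> N \<Longrightarrow> z \<in> ball z0 s \<Longrightarrow> h n z \<le> q"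
    unfolding P_def by blast
  \<comment> \<open>Eventually \<open>zs n\<close> lies in the disk where indices in
    \<open>N\<close> obey the bound \<open>q\<close>, yet \<open>h n (zs n)\<close> exceeds
    \<open>q\<close>; so \<open>N\<close> would be finite.\<close>
  have "\<forall>\<^sub>F n in sequentially. zs n \<in> ball z0 s \<and> q < h n (zs n)"
    using tendstoD[OF z0(2) s(1)] order_tendstoD(1)[OF lim s(2)]
    by eventually_elim (simp add: dist_commute)
  then have "\<forall>\<^sub>F n in sequentially. n \<notin> N"
  proof eventually_elim
    case (elim n)
    then show ?case using s(3)[of n "zs n"] by auto
  qed
  then show False
    using \<open>infinite N\<close> by (simp add: eventually_cofinite flip: cofinite_eq_sequentially)
qed

text \<open>If \<open>e n \<ge> \<epsilon>\<close> held infinitely often,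
  \<open>log_pole_decay\<close> at the points \<open>p n\<close> would give a common bound on a
  fixed disk about \<open>\<xi>\<close>, against \<open>no_uniform_decay\<close>.\<close>

lemma order_tendsto_0:
  assumes "\<xi> \<in> G" and p: "p \<longlonglongrightarrow> \<xi>"
    and e: "\<forall>\<^sub>F n in sequentially. \<exists>L>0. ((\<lambda>z. h n z / norm (z - p n) powr e n) \<longlongrightarrow> L) (at (p n))"
  shows "e \<longlonglongrightarrow> 0"
proof (rule tendstoI)
  fix \<epsilon> :: real assume "\<epsilon> > 0"
  obtain R C where R: "R > 0" "C > 0" "cball \<xi> R \<subseteq> G"
      "\<And>n. log_subsolution C (cball \<xi> R - {\<xi>}) (h n)"
    using sub[OF \<open>\<xi> \<in> G\<close>] by blast
  \<comment> \<open>Once \<open>p n\<close> is within \<open>r\<close> of \<open>\<xi>\<close>, its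
    disk of radius \<open>r\<close> lies in \<open>cball \<xi> R\<close>; once it is within
    \<open>t / 2\<close>, the fixed disk \<open>ball \<xi> (t / 2)\<close> lies in the decay disk
    \<open>ball (p n) t\<close>.\<close>
  define r where "r = R / 2"
  define t where "t = r * exp (- 1 - C * r\<^sup>2)"
  have r: "r > 0" "t > 0" using R by (auto simp: r_def t_def)
  define Q where "Q n \<longleftrightarrow> dist (p n) \<xi> < r \<and> dist (p n) \<xi> < t / 2 \<and>
    (\<exists>L>0. ((\<lambda>z. h n z / norm (z - p n) powr e n) \<longlongrightarrow> L) (at (p n)))" for n
  have Q: "\<forall>\<^sub>F n in sequentially. Q n"
    unfolding Q_def using r tendstoD[OF p, of r] tendstoD[OF p, of "t / 2"] e
    by (auto intro: eventually_conj)
  have powr0: "((\<lambda>z. norm (z - a) powr d) \<longlongrightarrow> 0) (at a)" if "d > 0" for a :: complex and d :: real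
  proof -
    have "((\<lambda>z. norm (z - a) powr d) \<longlongrightarrow> norm (a - a) powr d) (at a)"
      using that by (intro tendsto_intros) (auto intro!: always_eventually)
    then show ?thesis by simp
  qed
  have hQ: "p n \<in> G" "((\<lambda>z. h n z) \<longlongrightarrow> h n (p n)) (at (p n))" if "Q n" for n
  proof -
    have "p n \<in> cball \<xi> R"
      using that R(1) by (auto simp: Q_def r_def dist_commute)
    then show "p n \<in> G" using R(3) by blast
    then show "((\<lambda>z. h n z) \<longlongrightarrow> h n (p n)) (at (p n))"
      using cont G by (simp add: continuous_on_eq_continuous_at isCont_def)
  qed
  \<comment> \<open>The exponents will be differences of orders and could a priori be negative;
    finiteness of the limit of \<open>h n\<close> at \<open>p n\<close> excludes this, since it
    would force \<open>L = 0\<close>.\<close>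
  have nonneg: "e n \<ge> 0" if Qn: "Q n" for n
  proof (rule ccontr)
    assume "\<not> ?thesis"
    then have "e n < 0" by simp
    obtain L where L: "L > 0" "((\<lambda>z. h n z / norm (z - p n) powr e n) \<longlongrightarrow> L) (at (p n))"
      using Qn unfolding Q_def by blast
    have "((\<lambda>z. h n z * norm (z - p n) powr (- e n)) \<longlongrightarrow> h n (p n) * 0) (at (p n))"
      using \<open>e n < 0\<close> by (intro tendsto_mult hQ Qn powr0) auto
    then have "((\<lambda>z. h n z / norm (z - p n) powr e n) \<longlongrightarrow> 0) (at (p n))"
      by (simp add: powr_minus divide_inverse)
    then have "L = 0"
      using L(2) LIM_unique by blast
    with L(1) show False by simp
  qed
  define N where "N = {n. Q n \<and> e n \<ge> \<epsilon>}"
  \<comment> \<open>A pole of strength \<open>\<epsilon> / 2\<close>, strictly below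
    \<open>e n\<close>, is used: at strength \<open>e n\<close> the weighted limit would be the
    nonzero \<open>L\<close>.\<close>
  have decay: "h n z \<le> exp (- (\<epsilon> / 2))" if n: "n \<in> N" and z: "z \<in> ball \<xi> (t / 2)" for n z
  proof (rule log_pole_decay[where p = "p n" and r = r and C = C and a = \<xi>])
    have "Q n" "e n \<ge> \<epsilon>" using n by (auto simp: N_def)
    then obtain L where L: "L > 0" "((\<lambda>z. h n z / norm (z - p n) powr e n) \<longlongrightarrow> L) (at (p n))"
      unfolding Q_def by blast
    have pd: "dist (p n) \<xi> < r" "dist (p n) \<xi> < t / 2"
      using \<open>Q n\<close> by (auto simp: Q_def)
    have in_R: "cball (p n) r \<subseteq> cball \<xi> R"
      using pd R(1) unfolding cball_subset_cball_iff r_def by auto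
    show "continuous_on (cball (p n) r) (h n)"
      using in_R R(3) by (intro continuous_on_subset[OF cont]) auto
    show "h n ` cball (p n) r \<subseteq> {0..1}"
      using in_R R(3) range[of n] by blast
    show "log_subsolution C (ball (p n) r - {\<xi>}) (h n)"
      using in_R by (intro log_subsolution_subset[OF R(4)]) auto
    have mult: "((\<lambda>z. h n z * norm (z - p n) powr - d) \<longlongrightarrow> 0) (at (p n))" if "d < e n" for d
    proof -
      have "((\<lambda>z. h n z / norm (z - p n) powr e n * norm (z - p n) powr (e n - d)) \<longlongrightarrow> L * 0) (at (p n))"
        using that by (intro tendsto_mult L powr0) auto
      then have "((\<lambda>z. h n z / norm (z - p n) powr e n * norm (z - p n) powr (e n - d)) \<longlongrightarrow> 0) (at (p n))"
        by simp
      then show ?thesis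
        by (rule Lim_transform_eventually)
           (auto simp: eventually_at_filter powr_diff powr_minus divide_inverse)
    qed
    show "((\<lambda>z. h n z * norm (z - p n) powr - (\<epsilon> / 2)) \<longlongrightarrow> 0) (at (p n))"
      using \<open>\<epsilon> > 0\<close> \<open>e n \<ge> \<epsilon>\<close> by (intro mult) auto
    \<comment> \<open>Exponent 0 in \<open>mult\<close> gives plain convergence of
      \<open>h n\<close> to 0 at \<open>p n\<close>.\<close>
    have "((\<lambda>z. h n z * norm (z - p n) powr - 0) \<longlongrightarrow> 0) (at (p n))"
      using \<open>\<epsilon> > 0\<close> \<open>e n \<ge> \<epsilon>\<close> by (intro mult) auto
    then have "(h n \<longlongrightarrow> 0) (at (p n))"
      by (rule Lim_transform_eventually) (auto simp: eventually_at_filter)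
    then show "h n (p n) = 0"
      using hQ(2)[OF \<open>Q n\<close>] LIM_unique by blast
    show "z \<in> ball (p n) (r * exp (- 1 - C * r\<^sup>2))"
      using pd(2) z dist_triangle[of "p n" z \<xi>] by (simp add: t_def[symmetric])
  qed (use R r \<open>\<epsilon> > 0\<close> in auto)
  have "finite N"
  proof (rule ccontr)
    assume "infinite N"
    then show False
      by (rule no_uniform_decay[OF _ \<open>\<xi> \<in> G\<close>, where s = "t / 2" and q = "exp (- (\<epsilon> / 2))"])
         (use decay r \<open>\<epsilon> > 0\<close> in auto)
  qed
  then have "\<forall>\<^sub>F n in sequentially. n \<notin> N"
    by (simp add: eventually_cofinite flip: cofinite_eq_sequentially)
  then show "\<forall>\<^sub>F n in sequentially. dist (e n) 0 < \<epsilon>"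
    using Q
  proof eventually_elim
    case (elim n)
    then show ?case using nonneg[of n] by (auto simp: N_def)
  qed
qed

end

section \<open>From conformal pseudometrics to the family of quotients\<close>

text \<open>The curvature equation gives the Laplacians of \<open>ln lam\<close> and
  \<open>ln mu\<close>; their difference is estimated by comparing curvatures and then by
  \<open>1 + x \<le> exp x\<close> with \<open>x = 2 * ln (h z)\<close>.\<close>

lemma log_subsolution_quotient:
  assumes lam: "conformal_pseudometric G lam" and mu: "conformal_pseudometric G mu"
    and le: "pseudometric_le G lam mu" and h: "quotient_extension G lam mu h"
    and U: "U \<subseteq> G" "\<And>z. z \<in> U \<Longrightarrow> mu z > 0"
    and C: "\<And>z. z \<in> U \<Longrightarrow> curvature mu z \<le> 0"
      "\<And>z. z \<in> U \<Longrightarrow> 2 * - curvature mu z * (mu z)\<^sup>2 \<le> C"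
  shows "log_subsolution C U h"
  unfolding log_subsolution_def
proof (intro ballI impI)
  fix z assume z: "z \<in> U" "h z > 0"
  have zG: "z \<in> G" and mz: "mu z > 0" using U z by auto
  have hz: "h w = lam w / mu w" if "w \<in> G" "mu w > 0" for w
    using h that by (auto simp: quotient_extension_def)
  have lz: "lam z > 0"
    using z(2) hz[OF zG mz] mz by (simp add: zero_less_divide_iff)
  have op: "open {w\<in>G. f w > 0}" if "conformal_pseudometric G f" for f
  proof -
    have "open G" "continuous_on G f"
      using that by (auto simp: conformal_pseudometric_def)
    then have "open (G \<inter> f -` {0<..})"
      by (intro continuous_open_preimage) auto
    also have "G \<inter> f -` {0<..} = {w\<in>G. f w > 0}" by auto
    finally show ?thesis .
  qed
  have lap: "has_laplacian (\<lambda>w. ln (f w)) z (- curvature f z * (f z)\<^sup>2)"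
    if "conformal_pseudometric G f" "f z > 0" for f
  proof -
    have "has_laplacian (\<lambda>w. ln (f w)) z (laplacian (\<lambda>w. ln (f w)) z)"
      by (rule C2_on_has_laplacian_ln[of "{w\<in>G. f w > 0}"])
         (use that op[OF that(1)] zG in \<open>auto simp: conformal_pseudometric_def\<close>)
    then show ?thesis
      using that(2) by (simp add: curvature_def)
  qed
  let ?k = "- curvature mu z"
  define L where "L = - curvature lam z * (lam z)\<^sup>2 + (- 1) * (?k * (mu z)\<^sup>2)"
  have "has_laplacian (\<lambda>w. ln (lam w) + (- 1) * ln (mu w)) z L"
    unfolding L_def by (intro has_laplacian_add has_laplacian_cmult lap lam mu lz mz)
  then have "has_laplacian (\<lambda>w. ln (h w)) z L"
  proof (rule has_laplacian_cong)
    have "\<forall>\<^sub>F w in nhds z. w \<in> {w\<in>G. lam w > 0} \<inter> {w\<in>G. mu w > 0}"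
      using zG lz mz by (intro eventually_nhds_in_open open_Int op lam mu) auto
    then show "\<forall>\<^sub>F w in nhds z. ln (lam w) + (- 1) * ln (mu w) = ln (h w)"
      by eventually_elim (simp add: hz ln_div)
  qed
  moreover have "L \<ge> C * ln (h z)"
  proof -
    have "h z \<le> 1"
      using h zG by (auto simp: quotient_extension_def)
    then have ln0: "ln (h z) \<le> 0"
      using z(2) by simp
    have "1 + 2 * ln (h z) \<le> exp (2 * ln (h z))"
      by (rule exp_ge_add_one_self)
    also have "\<dots> = (h z)\<^sup>2"
      using z(2) by (simp add: exp_double)
    finally have "2 * ln (h z) \<le> (h z)\<^sup>2 - 1" by simp
    \<comment> \<open>As \<open>ln (h z) \<le> 0\<close>, enlarging the coefficient to
      \<open>C\<close> only lowers the product.\<close>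
    have "C * ln (h z) \<le> 2 * ?k * (mu z)\<^sup>2 * ln (h z)"
      using ln0 C(2)[OF z(1)] by (rule mult_right_mono_neg[rotated])
    also have "\<dots> = ?k * (mu z)\<^sup>2 * (2 * ln (h z))" by simp
    also have "\<dots> \<le> ?k * (mu z)\<^sup>2 * ((h z)\<^sup>2 - 1)"
      using C(1)[OF z(1)] \<open>2 * ln (h z) \<le> (h z)\<^sup>2 - 1\<close>
      by (intro mult_left_mono) (auto simp: mult_nonpos_nonneg)
    also have "\<dots> = ?k * (lam z)\<^sup>2 - ?k * (mu z)\<^sup>2"
    proof -
      have "lam z = h z * mu z" using hz[OF zG mz] mz by simp
      then show ?thesis by (simp add: power_mult_distrib algebra_simps)
    qed
    also have "\<dots> \<le> L"
    proof -
      have "curvature lam z \<le> curvature mu z"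
        using le zG lz mz by (simp add: pseudometric_le_def)
      then have "?k * (lam z)\<^sup>2 \<le> - curvature lam z * (lam z)\<^sup>2"
        by (intro mult_right_mono) auto
      then show ?thesis by (simp add: L_def)
    qed
    finally show ?thesis .
  qed
  ultimately show "\<exists>L\<ge>C * ln (h z). has_laplacian (\<lambda>w. ln (h w)) z L" by blast
qed

text \<open>Supplies the bound for \<open>\<kappa>\<close> on compact disks from which the constant
  \<open>C\<close> is taken.\<close>

lemma locally_holder_on_continuous:
  assumes "locally_holder_on G f"
  shows "continuous_on G f"
proof (rule continuous_at_imp_continuous_on, rule ballI)
  fix z assume "z \<in> G"
  then obtain r a C where r: "r > 0" "0 < a" "ball z r \<subseteq> G"
    "\<And>x y. x \<in> ball z r \<Longrightarrow> y \<in> ball z r \<Longrightarrow> \<bar>f x - f y\<bar> \<le> C * norm (x - y) powr a"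
    using assms unfolding locally_holder_on_def by blast
  have "((\<lambda>x. C * norm (x - z) powr a) \<longlongrightarrow> C * norm (z - z) powr a) (at z)"
    using r(2) by (intro tendsto_intros) (auto intro!: always_eventually)
  then have 1: "((\<lambda>x. C * norm (x - z) powr a) \<longlongrightarrow> 0) (at z)" by simp
  have "((\<lambda>x. f x - f z) \<longlongrightarrow> 0) (at z)"
  proof (rule Lim_null_comparison[OF _ 1])
    have "\<forall>\<^sub>F x in at z. x \<in> ball z r"
      using r(1) by (intro eventually_at_in_open') auto
    then show "\<forall>\<^sub>F x in at z. norm (f x - f z) \<le> C * norm (x - z) powr a"
      by eventually_elim (use r in auto)
  qed
  then show "isCont f z"
    by (simp add: isCont_def LIM_zero_iff)
qed

lemma only_isolated_zeros_punctured:
  assumes "open G" "continuous_on G f" "only_isolated_zeros G f" "z \<in> G"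
  shows "\<forall>\<^sub>F w in at z. f w \<noteq> 0"
proof (cases "f z = 0")
  case True
  then have "z isolated_in {z\<in>G. f z = 0}"
    using assms by (simp add: only_isolated_zeros_def discrete_def)
  then obtain T where T: "open T" "T \<inter> {z\<in>G. f z = 0} = {z}"
    by (auto simp: isolated_in_def)
  then have "\<forall>\<^sub>F w in at z. w \<in> T \<inter> G - {z}"
    using assms by (intro eventually_at_in_open) auto
  then show ?thesis
    by eventually_elim (use T in blast)
next
  case False
  have "(f \<longlongrightarrow> f z) (at z)"
    using assms by (simp add: continuous_on_eq_continuous_at isCont_def)
  with False show ?thesis
    by (rule tendsto_imp_eventually_ne[rotated])
qed

text \<open>Treats zeros and non-zeros alike: for order 0 the limit is \<open>f z\<close>, since
  \<open>powr 0\<close> equals 1 off \<open>z\<close>. Nonnegativity of \<open>f\<close> fixes the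
  sign of the limit.\<close>

lemma has_zero_order_limit:
  assumes "has_zero_order f z \<alpha>" "isCont f z" "\<forall>\<^sub>F w in at z. 0 \<le> f w"
  shows "\<exists>L>0. ((\<lambda>w. f w / norm (w - z) powr \<alpha>) \<longlongrightarrow> L) (at z)"
proof -
  obtain L where L: "L \<noteq> 0" "((\<lambda>w. f w / norm (w - z) powr \<alpha>) \<longlongrightarrow> L) (at z)"
  proof (cases "f z = 0")
    case False
    have "(f \<longlongrightarrow> f z) (at z)"
      using assms by (simp add: isCont_def)
    then have "((\<lambda>w. f w / norm (w - z) powr 0) \<longlongrightarrow> f z) (at z)"
      by (rule Lim_transform_eventually) (auto simp: eventually_at_filter)
    with False that show ?thesis
      using assms(1) by (auto simp: has_zero_order_def)
  qed (use assms(1) that in \<open>auto simp: has_zero_order_def\<close>)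
  have "0 \<le> L"
    by (rule tendsto_lowerbound[OF L(2)]) (use assms(3) in \<open>auto elim!: eventually_mono\<close>)
  with L show ?thesis by (intro exI[of _ L]) auto
qed

text \<open>Dividing the two limits subtracts the exponents; the removable zeros of
  \<open>mu\<close> near \<open>z\<close> do not interfere because they are isolated.\<close>

lemma quotient_order_limit:
  assumes lam: "conformal_pseudometric G lam" and mu: "conformal_pseudometric G mu"
    and iso: "only_isolated_zeros G mu" and h: "quotient_extension G lam mu h"
    and "z \<in> G" "has_zero_order lam z \<alpha>" "has_zero_order mu z \<beta>"
  shows "\<exists>L>0. ((\<lambda>w. h w / norm (w - z) powr (\<alpha> - \<beta>)) \<longlongrightarrow> L) (at z)"
proof -
  have G: "\<forall>\<^sub>F w in at z. w \<in> G"
    using mu \<open>z \<in> G\<close> by (intro eventually_at_in_open') (auto simp: conformal_pseudometric_def)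
  have f: "isCont f z" "\<forall>\<^sub>F w in at z. 0 \<le> f w" if "conformal_pseudometric G f" for f
    using that \<open>z \<in> G\<close> eventually_mono[OF G, of "\<lambda>w. 0 \<le> f w"]
    by (auto simp: conformal_pseudometric_def continuous_on_eq_continuous_at)
  obtain L where L: "L > 0" "((\<lambda>w. lam w / norm (w - z) powr \<alpha>) \<longlongrightarrow> L) (at z)"
    using has_zero_order_limit f[OF lam] assms by blast
  obtain M where M: "M > 0" "((\<lambda>w. mu w / norm (w - z) powr \<beta>) \<longlongrightarrow> M) (at z)"
    using has_zero_order_limit f[OF mu] assms by blast
  have "((\<lambda>w. (lam w / norm (w - z) powr \<alpha>) / (mu w / norm (w - z) powr \<beta>)) \<longlongrightarrow> L / M) (at z)"
    using L M by (intro tendsto_divide) auto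
  moreover have "\<forall>\<^sub>F w in at z. (lam w / norm (w - z) powr \<alpha>) / (mu w / norm (w - z) powr \<beta>)
      = h w / norm (w - z) powr (\<alpha> - \<beta>)"
  proof -
    have "\<forall>\<^sub>F w in at z. mu w \<noteq> 0"
      using only_isolated_zeros_punctured[OF _ _ iso \<open>z \<in> G\<close>] mu
      by (auto simp: conformal_pseudometric_def)
    then show ?thesis
      using G
      by eventually_elim (use h in \<open>simp add: quotient_extension_def powr_diff\<close>)
  qed
  ultimately have "((\<lambda>w. h w / norm (w - z) powr (\<alpha> - \<beta>)) \<longlongrightarrow> L / M) (at z)"
    by (rule Lim_transform_eventually)
  with L(1) M(1) show ?thesis
    by (intro exI[of _ "L / M"]) auto
qed

theorem theorem6p1:
  fixes lam :: "nat \<Rightarrow> complex \<Rightarrow> real" and mu \<kappa> :: "complex \<Rightarrow> real"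
    and zs :: "nat \<Rightarrow> complex" and z0 :: complex
  assumes "\<And>n. conformal_pseudometric (ball 0 1) (lam n)"
    and "conformal_pseudometric (ball 0 1) mu"
    and "\<And>n. only_isolated_zeros (ball 0 1) (lam n)"
    and "\<And>n \<xi>. \<xi> \<in> ball 0 1 \<Longrightarrow> lam n \<xi> = 0 \<Longrightarrow>
           \<exists>c. eventually (\<lambda>z. lam n z > 0 \<longrightarrow> curvature (lam n) z \<ge> c) (at \<xi>)"
    and "locally_holder_on (ball 0 1) \<kappa>"
    and "\<And>z. z \<in> ball 0 1 \<Longrightarrow> \<kappa> z \<le> -4"
    and "\<And>z. z \<in> ball 0 1 \<Longrightarrow> mu z > 0 \<Longrightarrow> curvature mu z = \<kappa> z"
    and "\<And>n. pseudometric_le (ball 0 1) (lam n) mu"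
    and "\<And>n. zs n \<in> ball 0 1" and "z0 \<in> ball 0 1" and "zs \<longlonglongrightarrow> z0"
    and "(\<lambda>n. quotient_value (ball 0 1) (lam n) mu (zs n)) \<longlonglongrightarrow> 1"
  shows "\<forall>\<xi>\<in>ball 0 1.
    (\<forall>(\<beta>::real) (b::nat \<Rightarrow> real).
       has_zero_order mu \<xi> \<beta> \<and> (\<forall>n. has_zero_order (lam n) \<xi> (b n)) \<longrightarrow> b \<longlonglongrightarrow> \<beta>) \<and>
    (\<forall>(zeta::nat \<Rightarrow> complex) (a::nat \<Rightarrow> real).
       (\<forall>n. zeta n \<in> ball 0 1 - {\<xi>} \<and> has_zero_order (lam n) (zeta n) (a n)) \<and> zeta \<longlonglongrightarrow> \<xi>
         \<longrightarrow> a \<longlonglongrightarrow> 0)"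
proof -
  let ?D = "ball 0 1 :: complex set"
  define h where "h n = quotient_value ?D (lam n) mu" for n
  have h: "quotient_extension ?D (lam n) mu (h n)" for n
  proof -
    have "\<exists>h. quotient_extension ?D (lam n) mu h"
      using assms(8)[of n] by (simp add: pseudometric_le_def)
    then show ?thesis
      unfolding h_def quotient_value_def by (rule someI_ex)
  qed
  have iso: "only_isolated_zeros ?D mu"
    using assms(8)[of 0] by (simp add: pseudometric_le_def)
  have mu: "continuous_on ?D mu" "\<And>z. z \<in> ?D \<Longrightarrow> 0 \<le> mu z"
    using assms(2) by (auto simp: conformal_pseudometric_def)
  have nz: "\<forall>\<^sub>F w in at z. mu w \<noteq> 0" if "z \<in> ?D" for z
    by (rule only_isolated_zeros_punctured[OF open_ball mu(1) iso that])
  interpret quasi_solution_family ?D h zs z0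
  proof
    show "continuous_on ?D (h n)" "h n ` ?D \<subseteq> {0..1}" for n
      using h[of n] by (auto simp: quotient_extension_def)
    show "(\<lambda>n. h n (zs n)) \<longlonglongrightarrow> 1"
      using assms(12) by (simp add: h_def)
    fix a assume a: "a \<in> ?D"
    \<comment> \<open>Zeros of \<open>mu\<close> are isolated, so in a small closed disk only the
      centre can be one.\<close>
    obtain R where R: "R > 0" "cball a R \<subseteq> ?D" "\<And>z. z \<in> cball a R \<Longrightarrow> z \<noteq> a \<Longrightarrow> mu z \<noteq> 0"
    proof -
      obtain d where d: "d > 0" "\<And>z. z \<noteq> a \<Longrightarrow> dist z a < d \<Longrightarrow> mu z \<noteq> 0"
        using nz[OF a] by (auto simp: eventually_at)
      obtain e where e: "e > 0" "cball a e \<subseteq> ?D"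
        using open_contains_cball[of ?D] a open_ball by blast
      show thesis
        by (rule that[of "min e (d / 2)"]) (use d e in \<open>auto simp: dist_commute\<close>)
    qed
    have "continuous_on (cball a R) (\<lambda>z. 2 * - \<kappa> z * (mu z)\<^sup>2)"
      using mu(1) locally_holder_on_continuous[OF assms(5)] R(2)
      by (intro continuous_intros) (auto intro: continuous_on_subset)
    then have "\<exists>x\<in>cball a R. \<forall>z\<in>cball a R. 2 * - \<kappa> z * (mu z)\<^sup>2 \<le> 2 * - \<kappa> x * (mu x)\<^sup>2"
      using R(1) by (intro continuous_attains_sup) auto
    then obtain x where x: "\<And>z. z \<in> cball a R \<Longrightarrow> 2 * - \<kappa> z * (mu z)\<^sup>2 \<le> 2 * - \<kappa> x * (mu x)\<^sup>2"
      by blast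
    \<comment> \<open>A maximum built from \<open>\<kappa>\<close> and \<open>mu\<close> alone,
      hence independent of \<open>n\<close>; the 1 ensures positivity.\<close>
    define C where "C = max 1 (2 * - \<kappa> x * (mu x)\<^sup>2)"
    have "log_subsolution C (cball a R - {a}) (h n)" for n
    proof (rule log_subsolution_quotient[OF assms(1,2,8) h])
      show pos: "mu z > 0" if "z \<in> cball a R - {a}" for z
        using R(2) R(3)[of z] mu(2)[of z] that by force
      fix z assume z: "z \<in> cball a R - {a}"
      then have zD: "z \<in> ?D" using R(2) by blast
      have \<kappa>: "curvature mu z = \<kappa> z"
        by (rule assms(7)[OF zD pos[OF z]])
      show "curvature mu z \<le> 0"
        using assms(6)[OF zD] by (simp add: \<kappa>)
      show "2 * - curvature mu z * (mu z)\<^sup>2 \<le> C"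
        using x[of z] z by (simp add: \<kappa> C_def)
    qed (use R in auto)
    then show "\<exists>R C. R > 0 \<and> C > 0 \<and> cball a R \<subseteq> ?D \<and> (\<forall>n. log_subsolution C (cball a R - {a}) (h n))"
      using R(1,2) by (intro exI[of _ R] exI[of _ C]) (auto simp: C_def)
  qed (use assms in auto)
  have order: "\<exists>L>0. ((\<lambda>w. h n w / norm (w - z) powr (\<alpha> - \<beta>)) \<longlongrightarrow> L) (at z)"
    if "z \<in> ?D" "has_zero_order (lam n) z \<alpha>" "has_zero_order mu z \<beta>" for n z \<alpha> \<beta>
    by (rule quotient_order_limit[OF assms(1,2) iso h that])
  show ?thesis
  proof (intro ballI conjI allI impI; elim conjE)
    fix \<xi> \<beta> b assume \<xi>: "\<xi> \<in> ?D" and "has_zero_order mu \<xi> \<beta>" "\<forall>n. has_zero_order (lam n) \<xi> (b n)"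
    then have "\<forall>\<^sub>F n in sequentially. \<exists>L>0. ((\<lambda>w. h n w / norm (w - \<xi>) powr (b n - \<beta>)) \<longlongrightarrow> L) (at \<xi>)"
      by (intro always_eventually allI order) auto
    \<comment> \<open>Part (a) is the case of the constant sequence of points
      \<open>\<xi>\<close>.\<close>
    then have "(\<lambda>n. b n - \<beta>) \<longlonglongrightarrow> 0"
      by (rule order_tendsto_0[OF \<xi> tendsto_const])
    then show "b \<longlonglongrightarrow> \<beta>"
      by (simp add: LIM_zero_iff)
  next
    fix \<xi> zeta a
    assume \<xi>: "\<xi> \<in> ?D" and lim: "zeta \<longlonglongrightarrow> \<xi>"
      and zeta: "\<forall>n. zeta n \<in> ?D - {\<xi>} \<and> has_zero_order (lam n) (zeta n) (a n)"
    \<comment> \<open>As \<open>zeta n\<close> avoids \<open>\<xi>\<close>, it eventually avoids the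
      zeros of \<open>mu\<close>; there \<open>mu\<close> has order 0 and the quotient has the full
      order \<open>a n\<close>.\<close>
    have "filterlim zeta (at \<xi>) sequentially"
      using lim zeta by (auto simp: filterlim_at)
    then have "\<forall>\<^sub>F n in sequentially. mu (zeta n) \<noteq> 0"
      by (rule eventually_compose_filterlim[OF nz[OF \<xi>]])
    then have "\<forall>\<^sub>F n in sequentially. \<exists>L>0.
        ((\<lambda>w. h n w / norm (w - zeta n) powr (a n)) \<longlongrightarrow> L) (at (zeta n))"
    proof eventually_elim
      case (elim n)
      then have "has_zero_order mu (zeta n) 0"
        by (simp add: has_zero_order_def)
      then show ?case
        using order[of "zeta n" n "a n" 0] zeta by simp
    qed
    then show "a \<longlonglongrightarrow> 0"
      by (rule order_tendsto_0[OF \<xi> lim])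
  qed
qed

end
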